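(* Let $m,n\geq 1$, $\nu\geq 0$ and $0\leq s\leq n$ be integers, let $k_1=\cdots=k_s=\nu+1$ and $k_{s+1}=\cdots=k_n=\nu$, and let $\Sigma=\Sigma^{k_1,\ldots,k_n;\mathbf{1}}_{m,n}$ be the associated symmetric multiple chessboard complex. If $m\geq n(\nu+1)+s-1$, then $\Sigma$ is shellable.
   Context: Consider the chessboard $[m]\times[n]$ with $m$ columns and $n$ rows; its squares are the vertices. For nonnegative integers $a_1,\dots,a_n$, the multiple chessboard complex $\Delta^{a_1,\ldots,a_n;\mathbf{1}}_{m,n}$ is the simplicial complex of all rook placements $A\subseteq[m]\times[n]$ with at most one rook in each column and at most $a_i$ rooks in the $i$-th row. The symmetric multiple chessboard complex is $\Sigma^{k_1,\ldots,k_n;\mathbf{1}}_{m,n}=\bigcup_{\pi\in S_n}\Delta^{k_{\pi(1)},\ldots,k_{\pi(n)};\mathbf{1}}_{m,n}$ (the union of these subcomplexes of the full simplex on $[m]\times[n]$). *)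

theory Defs
  imports Main "HOL-Combinatorics.Permutations"
begin

text \<open>Abstract simplicial complexes are families of faces; the empty face is a face.\<close>

definition finite_simplicial_complex :: "'a set set \<Rightarrow> bool" where
  "finite_simplicial_complex K \<longleftrightarrow>
     finite K \<and> {} \<in> K \<and> (\<forall>\<sigma>\<in>K. finite \<sigma> \<and> (\<forall>\<tau>. \<tau> \<subseteq> \<sigma> \<longrightarrow> \<tau> \<in> K))"

definition facets :: "'a set set \<Rightarrow> 'a set set" where
  "facets K = {F \<in> K. \<forall>\<sigma>\<in>K. F \<subseteq> \<sigma> \<longrightarrow> \<sigma> = F}"

definition face_dim :: "'a set \<Rightarrow> int" where
  "face_dim \<sigma> = int (card \<sigma>) - 1"

definition pure_of_dim :: "int \<Rightarrow> 'a set set \<Rightarrow> bool" where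
  "pure_of_dim d K \<longleftrightarrow> (\<forall>F\<in>facets K. face_dim F = d)"

text \<open>A shelling orders the facets linearly so that each facet but the first meets the subcomplex
  generated by its predecessors in a pure complex of codimension one.\<close>

definition shelling :: "'a set set \<Rightarrow> 'a set list \<Rightarrow> bool" where
  "shelling K Fs \<longleftrightarrow>
     distinct Fs \<and> set Fs = facets K \<and>
     (\<forall>j. 0 < j \<and> j < length Fs \<longrightarrow>
        pure_of_dim (face_dim (Fs ! j) - 1) ((\<Union>i<j. Pow (Fs ! i)) \<inter> Pow (Fs ! j)))"

text \<open>Shellability is meant in the classical sense, so that shellable complexes are pure.\<close>

definition shellable :: "'a set set \<Rightarrow> bool" where
  "shellable K \<longleftrightarrow>
     finite_simplicial_complex K \<and> (\<exists>d. pure_of_dim d K) \<and> (\<exists>Fs. shelling K Fs)"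

text \<open>A square is a pair of its column and its row, in this order.\<close>

definition multiple_chessboard_complex ::
    "nat \<Rightarrow> nat \<Rightarrow> (nat \<Rightarrow> nat) \<Rightarrow> (nat \<times> nat) set set" where
  "multiple_chessboard_complex m n a =
     {A. A \<subseteq> {1..m} \<times> {1..n} \<and>
         (\<forall>c\<in>{1..m}. card {r. (c, r) \<in> A} \<le> 1) \<and>
         (\<forall>i\<in>{1..n}. card {c. (c, i) \<in> A} \<le> a i)}"

definition symmetric_multiple_chessboard_complex ::
    "nat \<Rightarrow> nat \<Rightarrow> (nat \<Rightarrow> nat) \<Rightarrow> (nat \<times> nat) set set" where
  "symmetric_multiple_chessboard_complex m n k =
     (\<Union>\<pi>\<in>{\<pi>. \<pi> permutes {1..n}}. multiple_chessboard_complex m n (\<lambda>i. k (\<pi> i)))"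

end

theory Submission
  imports Defs "HOL-Library.List_Lexorder"
begin

text \<open>
  The hypothesis on \<open>m\<close> means exactly that every facet \<open>B\<close> leaves at least \<open>n - 1\<close> columns free.
  Let \<open>f 1 < f 2 < \<dots>\<close> be the free columns of \<open>B\<close>. They cut the board into gaps, and the
  \<open>i\<close>-th gap, between \<open>f (i - 1)\<close> and \<open>f i\<close>, is assigned to row \<open>i\<close>. The restriction of \<open>B\<close>
  consists of the rooks that lie outside the gap of their row, together with all rooks of a row
  \<open>i\<close> with \<open>\<nu> + 1\<close> rooks for which some row \<open>j < i\<close> has only \<open>\<nu>\<close> rooks. A rook of the
  restriction can be traded for a rook \<open>u\<close> so that \<open>u\<close> does not belong to the restriction of the
  new facet. If a facet \<open>A \<noteq> B\<close> contains the restriction of \<open>B\<close>, then \<open>A\<close> is strictly larger than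
  \<open>B\<close> in the lexicographic order that compares first the set of rows with \<open>\<nu> + 1\<close> rooks, then
  row \<open>1\<close>, then \<open>f 1\<close>, then row \<open>2\<close>, then \<open>f 2\<close>, and so on, where sets are compared by their
  sums. Hence sorting the facets by this order gives a shelling.
\<close>

section \<open>Shellability from a restriction map and a key\<close>

text \<open>If a face of \<open>F\<close> also lies in an earlier facet, \<open>less\<close> yields
  some \<open>v\<close> in \<open>R F\<close> missing from that facet, so the face lies in
  \<open>F - {v}\<close>. The facet that \<open>exch\<close> provides for \<open>v\<close> contains
  \<open>F - {v}\<close> and, by \<open>less\<close> again, precedes \<open>F\<close>. So every
  maximal common face has the form \<open>F - {v}\<close>.\<close>

lemma shellable_if_restriction:
  fixes K :: "'a set set" and R :: "'a set \<Rightarrow> 'a set" and key :: "'a set \<Rightarrow> 'b :: linorder"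
  assumes K: "finite_simplicial_complex K"
    and card: "\<And>F. F \<in> facets K \<Longrightarrow> card F = d"
    and sub: "\<And>F. F \<in> facets K \<Longrightarrow> R F \<subseteq> F"
    and less: "\<And>F G. \<lbrakk>F \<in> facets K; G \<in> facets K; F \<noteq> G; R F \<subseteq> G\<rbrakk> \<Longrightarrow> key F < key G"
    and exch: "\<And>F v. \<lbrakk>F \<in> facets K; v \<in> R F\<rbrakk> \<Longrightarrow>
      \<exists>G\<in>facets K. G \<noteq> F \<and> F - {v} \<subseteq> G \<and> R G \<subseteq> F"
  shows "shellable K"
proof -
  have "finite (facets K)"
    using K by (auto simp: finite_simplicial_complex_def facets_def)
  then obtain xs where xs: "set xs = facets K" "distinct xs"
    using finite_distinct_list by blast
  define Fs where "Fs = sort_key key xs"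
  have Fs: "set Fs = facets K" "distinct Fs" "sorted (map key Fs)"
    using xs by (auto simp: Fs_def)
  have "pure_of_dim (face_dim (Fs ! j) - 1) ((\<Union>i<j. Pow (Fs ! i)) \<inter> Pow (Fs ! j))"
    if j: "j < length Fs" for j
    unfolding pure_of_dim_def
  proof
    let ?C = "(\<Union>i<j. Pow (Fs ! i)) \<inter> Pow (Fs ! j)"
    fix \<sigma> assume \<sigma>: "\<sigma> \<in> facets ?C"
    have Fj: "Fs ! j \<in> facets K" using j Fs(1) nth_mem by blast
    have max: "\<tau> = \<sigma>" if "\<tau> \<in> ?C" "\<sigma> \<subseteq> \<tau>" for \<tau>
      using \<sigma> that unfolding facets_def by blast
    from \<sigma> obtain i where i: "i < j" "\<sigma> \<subseteq> Fs ! i" "\<sigma> \<subseteq> Fs ! j"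
      unfolding facets_def by blast
    have Fi: "Fs ! i \<in> facets K" using i j Fs(1) nth_mem by (metis less_trans)
    have ne: "Fs ! i \<noteq> Fs ! j" using i j Fs(2) by (simp add: nth_eq_iff_index_eq)
    have "key (Fs ! i) \<le> key (Fs ! j)"
      using sorted_nth_mono[OF Fs(3), of i j] i j by simp
    then have "\<not> R (Fs ! j) \<subseteq> Fs ! i"
      using less[OF Fj Fi] ne by auto
    then obtain v where v: "v \<in> R (Fs ! j)" "v \<notin> Fs ! i" by blast
    obtain G where G: "G \<in> facets K" "G \<noteq> Fs ! j" "Fs ! j - {v} \<subseteq> G" "R G \<subseteq> Fs ! j"
      using exch[OF Fj v(1)] by blast
    have "key G < key (Fs ! j)" using less[OF G(1) Fj G(2) G(4)] .
    moreover obtain l where l: "l < length Fs" "G = Fs ! l"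
      using G(1) Fs(1) by (metis in_set_conv_nth)
    ultimately have "l < j"
      using sorted_nth_mono[OF Fs(3), of j l] by (metis leD length_map not_le nth_map j)
    then have "Fs ! j - {v} \<in> ?C" using G l by auto
    moreover have "\<sigma> \<subseteq> Fs ! j - {v}" using i v by auto
    ultimately have \<sigma>_eq: "\<sigma> = Fs ! j - {v}" using max by blast
    have "finite (Fs ! j)" "v \<in> Fs ! j"
      using Fj K v(1) sub[OF Fj] by (auto simp: finite_simplicial_complex_def facets_def)
    then have "card (Fs ! j) = Suc (card \<sigma>)"
      unfolding \<sigma>_eq by (rule card.remove)
    then show "face_dim \<sigma> = face_dim (Fs ! j) - 1"
      by (simp add: face_dim_def)
  qed
  then have "shelling K Fs" using Fs by (auto simp: shelling_def)
  moreover have "pure_of_dim (int d - 1) K"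
    by (simp add: pure_of_dim_def face_dim_def card)
  ultimately show ?thesis using K unfolding shellable_def by blast
qed

section \<open>Comparing lists and sums; ranks in finite sets\<close>

lemma map_upt_less:
  fixes f g :: "nat \<Rightarrow> 'a :: linorder"
  assumes "a \<le> k" "k < b" "\<And>i. \<lbrakk>a \<le> i; i < k\<rbrakk> \<Longrightarrow> f i = g i" "f k < g k"
  shows "map f [a..<b] < map g [a..<b]"
proof -
  have "[a..<b] = [a..<k] @ k # [Suc k..<b]"
    using assms(1,2) by (metis le_add_diff_inverse less_imp_le_nat upt_add_eq_append upt_conv_Cons)
  then have "map h [a..<b] = map h [a..<k] @ h k # map h [Suc k..<b]" for h :: "nat \<Rightarrow> 'a"
    by simp
  moreover have "map f [a..<k] = map g [a..<k]" using assms(3) by simp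
  ultimately show ?thesis using assms(4)
    unfolding list_less_def by (metis case_prodI lexord_append_leftI lexord_cons_cons mem_Collect_eq)
qed

text \<open>Cancelling the common part leaves two nonempty sets of equal size, separated by the
  maximum of \<open>X - Y\<close>. Used both for sets of rows with \<open>\<nu> + 1\<close> rooks
  and for the columns occupied in one row.\<close>

lemma sum_less_if_diff_below:
  fixes X Y :: "nat set"
  assumes fin: "finite X" "finite Y" and card: "card X = card Y" and ne: "X \<noteq> Y"
    and below: "\<And>x y. \<lbrakk>x \<in> X - Y; y \<in> Y - X\<rbrakk> \<Longrightarrow> x < y"
  shows "\<Sum>X < \<Sum>Y"
proof -
  have cd: "card (X - Y) = card (Y - X)"
    using card fin by (simp add: card_Diff_subset_Int Int_commute)
  have ne': "X - Y \<noteq> {}"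
  proof
    assume "X - Y = {}"
    with cd have "card (Y - X) = 0" by (metis card.empty)
    then have "Y - X = {}" using fin by simp
    then show False using ne \<open>X - Y = {}\<close> by blast
  qed
  define d where "d = Max (X - Y)"
  have d: "d \<in> X - Y" and dmax: "\<And>x. x \<in> X - Y \<Longrightarrow> x \<le> d"
    using Max_in[of "X - Y"] Max_ge[of "X - Y"] ne' fin unfolding d_def by blast+
  have "\<Sum>(X - Y) \<le> card (X - Y) * d"
    using sum_bounded_above[of "X - Y" "\<lambda>x. x" d] dmax by simp
  also have "\<dots> < card (X - Y) * Suc d"
    using ne' fin by (simp add: card_gt_0_iff)
  also have "\<dots> \<le> \<Sum>(Y - X)"
    using sum_bounded_below[of "Y - X" "Suc d" "\<lambda>x. x"] below[OF d] cd by (simp add: Suc_le_eq)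
  finally have "\<Sum>(X - Y) < \<Sum>(Y - X)" .
  moreover have "\<Sum>X = \<Sum>(X - Y) + \<Sum>(X \<inter> Y)" "\<Sum>Y = \<Sum>(Y - X) + \<Sum>(X \<inter> Y)"
    using sum.Int_Diff[OF fin(1), of "\<lambda>x. x" Y] sum.Int_Diff[OF fin(2), of "\<lambda>x. x" X]
    by (simp_all add: Int_commute)
  ultimately show ?thesis by simp
qed

text \<open>Either the maximum has rank \<open>k\<close>, or it can be removed without changing the
  smaller ranks. This supplies the new column in \<open>exchange\<close>.\<close>

lemma ex_rank:
  fixes X :: "nat set"
  assumes "finite X" "k < card X"
  shows "\<exists>f\<in>X. card {x \<in> X. x < f} = k"
  using assms
proof (induction "card X" arbitrary: X)
  case (Suc p)
  then have ne: "X \<noteq> {}" by auto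
  define M where "M = Max X"
  have M: "M \<in> X" "\<And>x. x \<in> X \<Longrightarrow> x \<le> M" using Suc.prems ne by (auto simp: M_def)
  have lt: "{x \<in> X. x < M} = X - {M}" using M(2) by (auto simp: order.not_eq_order_implies_strict)
  have p: "p = card (X - {M})" using Suc M by simp
  show ?case
  proof (cases "k = p")
    case True
    then have "card {x \<in> X. x < M} = k" using lt p by simp
    then show ?thesis using M(1) by blast
  next
    case False
    then have "k < card (X - {M})" using Suc p by simp
    then have "\<exists>f\<in>X - {M}. card {x \<in> X - {M}. x < f} = k"
      by (intro Suc.hyps(1)[OF p]) (use Suc.prems(1) in auto)
    then obtain f where f: "f \<in> X - {M}" "card {x \<in> X - {M}. x < f} = k" by blast
    then have "f < M" using M(2)[of f] by auto
    then have "{x \<in> X - {M}. x < f} = {x \<in> X. x < f}" by auto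
    then show ?thesis using f by auto
  qed
qed simp

section \<open>Rows, faces, free columns and the key\<close>

definition row :: "(nat \<times> nat) set \<Rightarrow> nat \<Rightarrow> nat set" where
  "row A i = {c. (c, i) \<in> A}"

lemma row_insert: "row (insert (c, j) A) i = (if i = j then insert c (row A i) else row A i)"
  by (auto simp: row_def)

lemma row_remove: "row (A - {(c, j)}) i = (if i = j then row A i - {c} else row A i)"
  by (auto simp: row_def)

locale board =
  fixes m n \<nu> s :: nat
begin

definition big :: "(nat \<times> nat) set \<Rightarrow> nat set" where
  "big A = {i \<in> {1..n}. card (row A i) = Suc \<nu>}"

text \<open>For \<open>s \<le> n\<close> this is membership in the symmetric complex with the
  permutations eliminated: only the number of rows reaching \<open>\<nu> + 1\<close> matters, not
  which rows they are.\<close>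

definition face :: "(nat \<times> nat) set \<Rightarrow> bool" where
  "face A \<longleftrightarrow> A \<subseteq> {1..m} \<times> {1..n} \<and> (\<forall>c r r'. (c, r) \<in> A \<longrightarrow> (c, r') \<in> A \<longrightarrow> r = r') \<and>
     (\<forall>i\<in>{1..n}. card (row A i) \<le> Suc \<nu>) \<and> card (big A) \<le> s"

definition free :: "(nat \<times> nat) set \<Rightarrow> nat set" where
  "free A = {c \<in> {1..m}. \<forall>r. (c, r) \<notin> A}"

text \<open>The number of the gap of \<open>c\<close>, counted from 0, so the gap of row \<open>i\<close> has number \<open>i - 1\<close>.\<close>

definition gap :: "(nat \<times> nat) set \<Rightarrow> nat \<Rightarrow> nat" where
  "gap A c = card {x \<in> free A. x < c}"

definition restriction :: "(nat \<times> nat) set \<Rightarrow> (nat \<times> nat) set" where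
  "restriction A =
     {(c, i) \<in> A. Suc (gap A c) \<noteq> i \<or> i \<in> big A \<and> (\<exists>j\<in>{1..<i}. j \<notin> big A)}"

text \<open>The cardinality is the \<open>i\<close>-th free column (or \<open>Suc m\<close> if there is none). As it is below
  \<open>m + 2\<close>, the entry compares first the sum of row \<open>i\<close> and then this column.\<close>

definition key_entry :: "(nat \<times> nat) set \<Rightarrow> nat \<Rightarrow> nat" where
  "key_entry A i = \<Sum>(row A i) * (m + 2) + card {x \<in> {1..Suc m}. gap A x < i}"

definition key :: "(nat \<times> nat) set \<Rightarrow> nat list" where
  "key A = \<Sum>(big A) # map (key_entry A) [1..<Suc n]"

section \<open>Gaps, and counting rooks by rows\<close>

lemma finite_big [simp]: "finite (big A)"
  by (simp add: big_def)

lemma finite_free [simp]: "finite (free A)"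
  by (simp add: free_def)

lemma gap_mono: "x \<le> y \<Longrightarrow> gap A x \<le> gap A y"
  unfolding gap_def by (rule card_mono) auto

lemma gap_less: "\<lbrakk>x \<in> free A; x < y\<rbrakk> \<Longrightarrow> gap A x < gap A y"
  unfolding gap_def by (rule psubset_card_mono) auto

lemma face_colD: "\<lbrakk>face A; (c, r) \<in> A; (c, r') \<in> A\<rbrakk> \<Longrightarrow> r = r'"
  unfolding face_def by blast

lemma face_bounds: "\<lbrakk>face A; (c, r) \<in> A\<rbrakk> \<Longrightarrow> c \<in> {1..m} \<and> r \<in> {1..n}"
  unfolding face_def by blast

lemma face_finite: "face A \<Longrightarrow> finite A"
  unfolding face_def by (meson finite_SigmaI finite_atLeastAtMost finite_subset)

lemma face_row_le: "\<lbrakk>face A; i \<in> {1..n}\<rbrakk> \<Longrightarrow> card (row A i) \<le> Suc \<nu>"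
  unfolding face_def by blast

lemma face_big_le: "face A \<Longrightarrow> card (big A) \<le> s"
  unfolding face_def by blast

lemma finite_row: "finite A \<Longrightarrow> finite (row A i)"
  unfolding row_def by (rule finite_subset[of _ "fst ` A"]) force+

lemma card_eq_sum_row:
  assumes "finite A" "A \<subseteq> {1..m} \<times> {1..n}"
  shows "card A = (\<Sum>i\<in>{1..n}. card (row A i))"
proof -
  have "A = prod.swap ` (SIGMA i:{1..n}. row A i)"
    using assms by (force simp: row_def image_iff)
  then have "card A = card (SIGMA i:{1..n}. row A i)"
    by (metis card_image inj_swap)
  then show ?thesis using assms by (simp add: finite_row)
qed

lemma face_subset:
  assumes "face A" "B \<subseteq> A"
  shows "face B"
proof -
  have le: "card (row B i) \<le> card (row A i)" for i
    using assms finite_row[OF face_finite[OF assms(1)], of i]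
    by (intro card_mono) (auto simp: row_def)
  have "big B \<subseteq> big A"
    using le face_row_le[OF assms(1)] by (auto simp: big_def intro: antisym order_trans) (metis antisym atLeastAtMost_iff)
  then have "card (big B) \<le> s"
    using face_big_le[OF assms(1)] card_mono[OF finite_big] order_trans by blast
  then show ?thesis using assms le order_trans unfolding face_def by blast
qed

lemma sum_big: "(\<Sum>i\<in>{1..n}. \<nu> + (if i \<in> big A then 1 else 0)) = n * \<nu> + card (big A)"
proof -
  have "{1..n} \<inter> big A = big A" by (auto simp: big_def)
  then have "(\<Sum>i\<in>{1..n}. if i \<in> big A then 1 else 0 :: nat) = card (big A)"
    by (simp add: sum.If_cases)
  then show ?thesis by (simp add: sum.distrib)
qed

lemma face_row_le_big:
  "\<lbrakk>face A; i \<in> {1..n}\<rbrakk> \<Longrightarrow> card (row A i) \<le> \<nu> + (if i \<in> big A then 1 else 0)"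
  using face_row_le[of A i] by (auto simp: big_def)

lemma face_card_le_big: "face A \<Longrightarrow> card A \<le> n * \<nu> + card (big A)"
  using sum_mono[of "{1..n}" "\<lambda>i. card (row A i)" "\<lambda>i. \<nu> + (if i \<in> big A then 1 else 0)"]
    face_row_le_big[of A] card_eq_sum_row[OF face_finite, of A] sum_big[of A]
  by (simp add: face_def)

lemma face_card_le: "face A \<Longrightarrow> card A \<le> n * \<nu> + s"
  using face_card_le_big[of A] face_big_le[of A] by simp

lemma full_big: "\<lbrakk>face A; card A = n * \<nu> + s\<rbrakk> \<Longrightarrow> card (big A) = s"
  using face_card_le_big[of A] face_big_le[of A] by simp

text \<open>By \<open>sum_big\<close> and \<open>full_big\<close> the bounds for the single rows add
  up to the number of rooks, so none of them can be strict.\<close>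

lemma full_row:
  assumes "face A" "card A = n * \<nu> + s" "i \<in> {1..n}"
  shows "card (row A i) = \<nu> + (if i \<in> big A then 1 else 0)"
proof (rule ccontr)
  assume "card (row A i) \<noteq> \<nu> + (if i \<in> big A then 1 else 0)"
  then have "card (row A i) < \<nu> + (if i \<in> big A then 1 else 0)"
    using face_row_le_big[OF assms(1,3)] by simp
  then have "(\<Sum>i\<in>{1..n}. card (row A i)) < (\<Sum>i\<in>{1..n}. \<nu> + (if i \<in> big A then 1 else 0))"
    using assms(3) face_row_le_big[OF assms(1)] by (intro sum_strict_mono_ex1 bexI[of _ i]) auto
  then show False
    using sum_big[of A] full_big[OF assms(1,2)] assms(2)
      card_eq_sum_row[OF face_finite, of A] assms(1) by (simp add: face_def)
qed

lemma card_free: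
  assumes "face A"
  shows "card (free A) + card A = m"
proof -
  have "inj_on fst A" using assms by (auto simp: inj_on_def dest: face_colD)
  then have "card (fst ` A) = card A" by (rule card_image)
  moreover have "free A = {1..m} - fst ` A" by (force simp: free_def)
  moreover have "fst ` A \<subseteq> {1..m}" using assms by (force simp: face_def)
  ultimately show ?thesis using card_mono[of "{1..m}" "fst ` A"]
    by (simp add: card_Diff_subset finite_subset)
qed

section \<open>The symmetric complex without permutations\<close>

lemma symmetric_multiple_chessboard_complex_eq:
  assumes "s \<le> n" and k1: "\<And>i. i \<in> {1..s} \<Longrightarrow> k i = Suc \<nu>"
    and k2: "\<And>i. i \<in> {s + 1..n} \<Longrightarrow> k i = \<nu>"
  shows "symmetric_multiple_chessboard_complex m n k = {A. face A}"
proof (intro set_eqI iffI)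
  fix A
  assume "A \<in> symmetric_multiple_chessboard_complex m n k"
  then obtain \<pi> where \<pi>: "\<pi> permutes {1..n}" and A: "A \<subseteq> {1..m} \<times> {1..n}"
    "\<And>c. c \<in> {1..m} \<Longrightarrow> card {r. (c, r) \<in> A} \<le> 1"
    "\<And>i. i \<in> {1..n} \<Longrightarrow> card (row A i) \<le> k (\<pi> i)"
    unfolding symmetric_multiple_chessboard_complex_def multiple_chessboard_complex_def row_def
    by auto
  have \<pi>in: "\<pi> i \<in> {1..n}" if "i \<in> {1..n}" for i using \<pi> that by (meson permutes_in_image)
  have kval: "k i = (if i \<le> s then Suc \<nu> else \<nu>)" if "i \<in> {1..n}" for i
    using k1[of i] k2[of i] that by auto
  have col: "r = r'" if "(c, r) \<in> A" "(c, r') \<in> A" for c r r'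
  proof -
    have "finite {r. (c, r) \<in> A}"
      by (rule finite_subset[of _ "{1..n}"]) (use A(1) in auto)
    moreover have "card {r. (c, r) \<in> A} \<le> Suc 0" using that A(1) A(2)[of c] by auto
    ultimately show ?thesis using that by (auto simp: card_le_Suc0_iff_eq)
  qed
  have "card (row A i) \<le> Suc \<nu>" if "i \<in> {1..n}" for i
    using A(3)[OF that] kval[OF \<pi>in[OF that]] by (auto split: if_splits)
  \<comment> \<open>A row with \<open>\<nu> + 1\<close> rooks needs capacity
    \<open>\<nu> + 1\<close>, so \<open>\<pi>\<close> sends it into \<open>{1..s}\<close>;
    injectivity then bounds the number of such rows.\<close>
  moreover have "\<pi> ` big A \<subseteq> {1..s}"
  proof (rule image_subsetI)
    fix i assume i: "i \<in> big A"
    then have "Suc \<nu> \<le> k (\<pi> i)" "i \<in> {1..n}" using A(3)[of i] by (auto simp: big_def)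
    then show "\<pi> i \<in> {1..s}" using kval[OF \<pi>in, of i] \<pi>in[of i] by (auto split: if_splits)
  qed
  then have "card (big A) \<le> s"
    using card_inj_on_le[of \<pi> "big A" "{1..s}"] \<pi> by (simp add: permutes_inj_on)
  ultimately show "A \<in> {A. face A}" using A(1) col unfolding face_def by blast
next
  fix A
  assume "A \<in> {A. face A}"
  then have A: "face A" by simp
  \<comment> \<open>Fewer than \<open>s\<close> rows may be big. After padding to exactly
    \<open>s\<close> rows, \<open>\<pi>\<close> can carry \<open>T\<close> onto
    \<open>{1..s}\<close> and the other rows onto \<open>{s + 1..n}\<close>.\<close>
  obtain T where T: "big A \<subseteq> T" "T \<subseteq> {1..n}" "card T = s"
    using exists_subset_between[of "big A" s "{1..n}"] face_big_le[OF A] assms(1)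
    by (metis (no_types, lifting) big_def card_atLeastAtMost diff_Suc_1 finite_atLeastAtMost mem_Collect_eq subsetI)
  have finT: "finite T" using T(2) finite_subset by blast
  obtain f where f: "bij_betw f T {1..s}"
    using finite_same_card_bij[OF finT, of "{1..s}"] T(3) by auto
  have "card ({1..n} - T) = card {s + 1..n}"
    using T finT by (simp add: card_Diff_subset)
  then obtain g where g: "bij_betw g ({1..n} - T) {s + 1..n}"
    using finite_same_card_bij[of "{1..n} - T" "{s + 1..n}"] by auto
  define \<pi> where "\<pi> i = (if i \<in> T then f i else if i \<in> {1..n} then g i else i)" for i
  have "bij_betw \<pi> T {1..s}"
    using f bij_betw_cong[of T \<pi> f] by (simp add: \<pi>_def)
  moreover have "bij_betw \<pi> ({1..n} - T) {s + 1..n}"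
    using g bij_betw_cong[of "{1..n} - T" \<pi> g] by (simp add: \<pi>_def)
  ultimately have "bij_betw \<pi> (T \<union> ({1..n} - T)) ({1..s} \<union> {s + 1..n})"
    by (rule bij_betw_combine) auto
  moreover have "T \<union> ({1..n} - T) = {1..n}" using T by auto
  moreover have "{1..s} \<union> {s + 1..n} = {1..n}" using assms(1) by auto
  ultimately have "bij_betw \<pi> {1..n} {1..n}" by simp
  then have perm: "\<pi> permutes {1..n}"
    using T by (intro bij_imp_permutes) (auto simp: \<pi>_def)
  have "card (row A i) \<le> k (\<pi> i)" if i: "i \<in> {1..n}" for i
  proof (cases "i \<in> T")
    case True
    then have "\<pi> i \<in> {1..s}" using f by (auto simp: \<pi>_def bij_betw_def)
    then show ?thesis using face_row_le[OF A i] k1 by simp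
  next
    case False
    then have "\<pi> i \<in> {s + 1..n}" using g i by (auto simp: \<pi>_def bij_betw_def)
    moreover have "i \<notin> big A" using T(1) False by blast
    ultimately show ?thesis using face_row_le_big[OF A i] k2 by simp
  qed
  moreover have "card {r. (c, r) \<in> A} \<le> 1" for c
  proof (rule ccontr)
    assume "\<not> card {r. (c, r) \<in> A} \<le> 1"
    then have "2 \<le> card {r. (c, r) \<in> A}" by simp
    then obtain r r' where "r \<noteq> r'" "(c, r) \<in> A" "(c, r') \<in> A"
      by (auto simp: card_le_Suc_iff numeral_2_eq_2)
    then show False using face_colD[OF A] by blast
  qed
  ultimately show "A \<in> symmetric_multiple_chessboard_complex m n k"
    using perm A
    unfolding symmetric_multiple_chessboard_complex_def multiple_chessboard_complex_def row_def face_def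
    by auto
qed

section \<open>Extending faces, and the facets\<close>

lemma face_insert:
  assumes A: "face A" and c: "c \<in> free A" and r: "r \<in> {1..n}"
    and room: "card (row A r) < \<nu> \<or> card (row A r) = \<nu> \<and> card (big A) < s"
  shows "face (insert (c, r) A)"
proof -
  have cd: "card (insert c (row A r)) = Suc (card (row A r))"
    using c finite_row[OF face_finite[OF A]] by (simp add: free_def row_def)
  have "card (big (insert (c, r) A)) \<le> s"
  proof (cases "card (row A r) < \<nu>")
    case True
    then have "big (insert (c, r) A) \<subseteq> big A"
      using cd by (auto simp: big_def row_insert split: if_splits)
    then show ?thesis using face_big_le[OF A] card_mono[OF finite_big] order_trans by blast
  next
    case False
    have "big (insert (c, r) A) \<subseteq> insert r (big A)"
      by (auto simp: big_def row_insert split: if_splits)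
    then have "card (big (insert (c, r) A)) \<le> Suc (card (big A))"
      using card_mono[OF finite.insertI[OF finite_big]] card_insert_le_m1 card_insert_if[OF finite_big, of r A]
      by (metis le_SucI order_refl order_trans)
    then show ?thesis using False room by simp
  qed
  then show ?thesis
    using A c r cd room unfolding face_def free_def row_insert by auto
qed

text \<open>A face with fewer rooks can be extended: it has a free column since
  \<open>n * \<nu> + s \<le> m\<close>, and a row with room, since otherwise all rows have at least
  \<open>\<nu>\<close> rooks and fewer than \<open>s \<le> n\<close> are big, so that some row with
  exactly \<open>\<nu>\<close> may still grow.\<close>

lemma facets_face:
  assumes "s \<le> n" "n * \<nu> + s \<le> m"
  shows "facets {A. face A} = {A. face A \<and> card A = n * \<nu> + s}"
proof (intro set_eqI iffI; clarsimp)
  fix A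
  assume "A \<in> facets {A. face A}"
  then have A: "face A" and max: "\<And>B. \<lbrakk>face B; A \<subseteq> B\<rbrakk> \<Longrightarrow> B = A"
    by (auto simp: facets_def)
  have "card A = n * \<nu> + s"
  proof (rule ccontr)
    assume "card A \<noteq> n * \<nu> + s"
    then have lt: "card A < n * \<nu> + s" using face_card_le[OF A] by simp
    then have "card (free A) \<noteq> 0" using card_free[OF A] assms(2) by linarith
    then obtain c where c: "c \<in> free A" by fastforce
    have "\<exists>r\<in>{1..n}. card (row A r) < \<nu> \<or> card (row A r) = \<nu> \<and> card (big A) < s"
    proof (rule ccontr)
      assume *: "\<not> ?thesis"
      then have ge: "\<nu> \<le> card (row A i)" if "i \<in> {1..n}" for i using that by force
      then have "\<nu> + (if i \<in> big A then 1 else 0) \<le> card (row A i)" if "i \<in> {1..n}" for i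
        using that by (auto simp: big_def)
      then have "n * \<nu> + card (big A) \<le> card A"
        using sum_mono[of "{1..n}" "\<lambda>i. \<nu> + (if i \<in> big A then 1 else 0)" "\<lambda>i. card (row A i)"]
          card_eq_sum_row[OF face_finite, of A] sum_big[of A] A by (simp add: face_def)
      then have bs: "card (big A) < s" using lt by simp
      have "big A \<noteq> {1..n}" using bs assms(1) by auto
      moreover have "big A \<subseteq> {1..n}" by (auto simp: big_def)
      ultimately obtain r where r: "r \<in> {1..n}" "r \<notin> big A" by blast
      then have "card (row A r) = \<nu>"
        using ge[OF r(1)] face_row_le_big[OF A r(1)] by simp
      then show False using * r bs by blast
    qed
    then obtain r where "r \<in> {1..n}" "face (insert (c, r) A)" using face_insert[OF A c] by blast
    then have "(c, r) \<in> A" using max by blast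
    then show False using c by (simp add: free_def)
  qed
  then show "face A \<and> card A = n * \<nu> + s" using A by simp
next
  fix A
  assume A: "face A" "card A = n * \<nu> + s"
  have "B = A" if "face B" "A \<subseteq> B" for B
    using card_seteq[OF face_finite[OF that(1)] that(2)] face_card_le[OF that(1)] A(2) by simp
  then show "A \<in> facets {A. face A}" using A by (simp add: facets_def)
qed

section \<open>Containing the restriction increases the key\<close>

lemma restriction_subset: "restriction A \<subseteq> A"
  by (auto simp: restriction_def)

text \<open>One step of the lexicographic comparison. The columns with \<open>gap B c < k\<close>
  are those up to the \<open>k\<close>-th free column of \<open>B\<close> (all columns if it does
  not exist). The driving fact is that a rook of \<open>B\<close> missing from \<open>A\<close> is
  not in the restriction, hence lies in the gap of its row.\<close>

lemma key_entry_step: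
  assumes A: "face A" and B: "face B"
    and cards: "\<And>i. i \<in> {1..n} \<Longrightarrow> card (row A i) = card (row B i)"
    and sub: "restriction B \<subseteq> A" and k: "k < n"
    and agree: "\<And>c r. \<lbrakk>c \<in> {1..m}; gap B c < k\<rbrakk> \<Longrightarrow> (c, r) \<in> A \<longleftrightarrow> (c, r) \<in> B"
  shows "key_entry B (Suc k) < key_entry A (Suc k) \<or>
    key_entry B (Suc k) = key_entry A (Suc k) \<and> row A (Suc k) = row B (Suc k) \<and>
    (\<forall>c\<in>{1..m}. gap B c < Suc k \<longrightarrow> (\<forall>r. (c, r) \<in> A \<longleftrightarrow> (c, r) \<in> B))"
proof (cases "row A (Suc k) = row B (Suc k)")
  case False
  have "\<Sum>(row B (Suc k)) < \<Sum>(row A (Suc k))"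
  proof (rule sum_less_if_diff_below)
    fix c a
    assume c: "c \<in> row B (Suc k) - row A (Suc k)" and a: "a \<in> row A (Suc k) - row B (Suc k)"
    show "c < a"
    proof (rule ccontr)
      assume "\<not> c < a"
      with a c have ac: "a < c" by (metis DiffD1 DiffD2 linorder_neqE_nat)
      have "(c, Suc k) \<in> B - restriction B" using c sub by (auto simp: row_def)
      then have gc: "gap B c = k" by (auto simp: restriction_def)
      have am: "a \<in> {1..m}" using a face_bounds[OF A] by (auto simp: row_def)
      \<comment> \<open>So \<open>a\<close> lies in the same gap as \<open>c\<close> and is occupied
        in \<open>B\<close>, by a rook of another row. That rook is outside the gap of its row, so
        it belongs to the restriction and to \<open>A\<close>, where column \<open>a\<close> already
        has a rook in row \<open>Suc k\<close>.\<close>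
      have "\<not> gap B a < k" using agree[OF am, of "Suc k"] a by (auto simp: row_def)
      then have ga: "gap B a = k" using gap_mono[of a c B] ac gc by simp
      then have "a \<notin> free B" using gap_less[of a B c] ac gc by auto
      then obtain j where j: "(a, j) \<in> B" using am by (auto simp: free_def)
      have "j \<noteq> Suc k" using a j by (auto simp: row_def)
      then have "(a, j) \<in> restriction B" using j ga by (auto simp: restriction_def)
      then have "(a, j) \<in> A" using sub by blast
      then show False using face_colD[OF A, of a j "Suc k"] a \<open>j \<noteq> Suc k\<close> by (auto simp: row_def)
    qed
  qed (use False A B cards[of "Suc k"] k in \<open>auto intro: finite_row face_finite\<close>)
  \<comment> \<open>A larger row sum gains at least \<open>m + 2\<close>, while the column part is
    at most \<open>m + 1\<close>.\<close>
  then have "Suc (\<Sum>(row B (Suc k))) * (m + 2) \<le> \<Sum>(row A (Suc k)) * (m + 2)"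
    by (intro mult_right_mono) auto
  moreover have "card {x \<in> {1..Suc m}. gap B x < Suc k} \<le> card {1..Suc m}"
    by (rule card_mono) auto
  ultimately show ?thesis unfolding key_entry_def by simp
next
  case True
  \<comment> \<open>Such a rook is covered by \<open>agree\<close>, by the equality of the rows
    \<open>Suc k\<close>, or, being in gap \<open>k\<close> but in another row, by the
    restriction.\<close>
  have occ: "(c, j) \<in> A" if "(c, j) \<in> B" "gap B c \<le> k" for c j
  proof (cases "gap B c < k \<or> j = Suc k")
    case True
    then show ?thesis using \<open>row A (Suc k) = row B (Suc k)\<close> that agree[of c j] face_bounds[OF B]
      by (auto simp: row_def)
  next
    case False
    then have "(c, j) \<in> restriction B" using that by (auto simp: restriction_def)
    then show ?thesis using sub by blast
  qed
  have free_sub: "c \<in> free B" if "c \<in> free A" "gap B c \<le> k" for c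
    using that occ[of c] by (auto simp: free_def)
  have gap_le: "gap A x \<le> gap B x" if "gap B x \<le> k" for x
    unfolding gap_def using free_sub that gap_mono[of _ x B]
    by (intro card_mono) (auto intro: order_trans less_imp_le)
  \<comment> \<open>These sets are initial segments ending at the free column number
    \<open>k + 1\<close>, which therefore comes no earlier in \<open>A\<close> than in
    \<open>B\<close>.\<close>
  have hsub: "{x \<in> {1..Suc m}. gap B x < Suc k} \<subseteq> {x \<in> {1..Suc m}. gap A x < Suc k}"
    using gap_le by (auto simp: less_Suc_eq_le intro: order_trans)
  show ?thesis
  proof (cases "{x \<in> {1..Suc m}. gap B x < Suc k} = {x \<in> {1..Suc m}. gap A x < Suc k}")
    case False
    then have "card {x \<in> {1..Suc m}. gap B x < Suc k} < card {x \<in> {1..Suc m}. gap A x < Suc k}"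
      using hsub by (intro psubset_card_mono) auto
    then show ?thesis using True by (simp add: key_entry_def)
  next
    case heq: True
    have "(c, r) \<in> B" if c: "c \<in> {1..m}" "gap B c < Suc k" "(c, r) \<in> A" for c r
    proof (cases "c \<in> free B")
      case False
      then obtain j where "(c, j) \<in> B" using c by (auto simp: free_def)
      then show ?thesis using occ[of c j] c face_colD[OF A] by (auto simp: less_Suc_eq_le)
    next
      case cB: True
      have "c \<notin> free A" using c by (auto simp: free_def)
      then have ps: "{x \<in> free A. x < Suc c} \<subset> {x \<in> free B. x < Suc c}"
        using cB free_sub gap_mono[of _ c B] c(2) by (auto simp: less_Suc_eq_le intro: order_trans)
      have SB: "{x \<in> free B. x < Suc c} = insert c {x \<in> free B. x < c}" using cB by auto
      have "gap B (Suc c) = Suc (gap B c)" unfolding gap_def SB by simp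
      moreover have "gap A (Suc c) < gap B (Suc c)"
        unfolding gap_def by (rule psubset_card_mono[OF _ ps]) simp
      ultimately have lt: "gap A (Suc c) < Suc k" using c(2) by simp
      \<comment> \<open>As \<open>Suc c\<close> may be \<open>Suc m\<close>, the range in
        \<open>key_entry\<close> has to reach \<open>Suc m\<close>.\<close>
      then have "gap B (Suc c) < Suc k" using heq c(1) by auto
      then have "gap B c < k" using \<open>gap B (Suc c) = Suc (gap B c)\<close> by simp
      then show ?thesis using agree c by blast
    qed
    then have "\<forall>c\<in>{1..m}. gap B c < Suc k \<longrightarrow> (\<forall>r. (c, r) \<in> A \<longleftrightarrow> (c, r) \<in> B)"
      using occ by (auto simp: less_Suc_eq_le)
    then show ?thesis using True heq by (simp add: key_entry_def)
  qed
qed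

lemma key_less:
  assumes A: "face A" "card A = n * \<nu> + s" and B: "face B" "card B = n * \<nu> + s"
    and ne: "B \<noteq> A" and sub: "restriction B \<subseteq> A"
  shows "key B < key A"
proof (cases "big A = big B")
  case False
  have "\<Sum>(big B) < \<Sum>(big A)"
  proof (rule sum_less_if_diff_below)
    show "card (big B) = card (big A)" using full_big A B by simp
    fix i j assume i: "i \<in> big B - big A" and j: "j \<in> big A - big B"
    show "i < j"
    proof (rule ccontr)
      assume "\<not> i < j"
      with i j have "j < i" by (metis DiffD1 DiffD2 linorder_neqE_nat)
      moreover have "1 \<le> j" using j by (simp add: big_def)
      \<comment> \<open>Row \<open>i\<close> is big in \<open>B\<close> and has the smaller row
        \<open>j\<close> that is not, so all its rooks lie in the restriction. Hence row
        \<open>i\<close> would be big in \<open>A\<close> too.\<close>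
      ultimately have "row B i \<subseteq> row A i"
        using i j sub by (force simp: row_def restriction_def)
      then have "card (row B i) \<le> card (row A i)"
        using finite_row[OF face_finite[OF A(1)]] by (rule card_mono[rotated])
      then show False using i face_row_le[OF A(1), of i] by (auto simp: big_def)
    qed
  qed (use False in auto)
  then show ?thesis by (simp add: key_def)
next
  case True
  have cards: "card (row A i) = card (row B i)" if "i \<in> {1..n}" for i
    using full_row[OF A that] full_row[OF B that] True by simp
  \<comment> \<open>Invariant: a first strict increase has occurred among the first \<open>k\<close>
    entries, or \<open>A\<close> and \<open>B\<close> agree in the first \<open>k\<close> rows and
    up to the \<open>k\<close>-th free column of \<open>B\<close>. For \<open>k = 0\<close> the
    second case is vacuous.\<close>
  have "(\<exists>i\<in>{1..k}. key_entry B i < key_entry A i \<and> (\<forall>j\<in>{1..<i}. key_entry B j = key_entry A j)) \<or>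
    (\<forall>i\<in>{1..k}. key_entry B i = key_entry A i \<and> row A i = row B i) \<and>
    (\<forall>c\<in>{1..m}. gap B c < k \<longrightarrow> (\<forall>r. (c, r) \<in> A \<longleftrightarrow> (c, r) \<in> B))" if "k \<le> n" for k
    using that
  proof (induction k)
    case (Suc k)
    then consider "\<exists>i\<in>{1..k}. key_entry B i < key_entry A i \<and> (\<forall>j\<in>{1..<i}. key_entry B j = key_entry A j)"
      | "\<forall>i\<in>{1..k}. key_entry B i = key_entry A i \<and> row A i = row B i"
        "\<forall>c\<in>{1..m}. gap B c < k \<longrightarrow> (\<forall>r. (c, r) \<in> A \<longleftrightarrow> (c, r) \<in> B)"
      by linarith
    then show ?case
    proof cases
      case 1
      then show ?thesis by fastforce
    next
      case 2
      have "key_entry B (Suc k) < key_entry A (Suc k) \<or>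
        key_entry B (Suc k) = key_entry A (Suc k) \<and> row A (Suc k) = row B (Suc k) \<and>
        (\<forall>c\<in>{1..m}. gap B c < Suc k \<longrightarrow> (\<forall>r. (c, r) \<in> A \<longleftrightarrow> (c, r) \<in> B))"
        using Suc.prems 2(2) by (intro key_entry_step[OF A(1) B(1) cards sub]) auto
      then show ?thesis
      proof
        assume "key_entry B (Suc k) < key_entry A (Suc k)"
        then show ?thesis using 2(1) by (intro disjI1 bexI[of _ "Suc k"]) auto
      next
        assume *: "key_entry B (Suc k) = key_entry A (Suc k) \<and> row A (Suc k) = row B (Suc k) \<and>
          (\<forall>c\<in>{1..m}. gap B c < Suc k \<longrightarrow> (\<forall>r. (c, r) \<in> A \<longleftrightarrow> (c, r) \<in> B))"
        then show ?thesis using 2(1) by (intro disjI2) (auto simp: atLeastAtMostSuc_conv)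
      qed
    qed
  qed simp
  from this[of n] consider i where "i \<in> {1..n}" "key_entry B i < key_entry A i"
      "\<forall>j\<in>{1..<i}. key_entry B j = key_entry A j"
    | "\<forall>i\<in>{1..n}. row A i = row B i" by blast
  then show ?thesis
  proof cases
    case 1
    then have "map (key_entry B) [1..<Suc n] < map (key_entry A) [1..<Suc n]"
      by (intro map_upt_less[of 1 i]) auto
    then show ?thesis using True by (simp add: key_def)
  next
    case 2
    have "(c, i) \<in> A \<longleftrightarrow> (c, i) \<in> B" for c i
      using 2 face_bounds[OF A(1), of c i] face_bounds[OF B(1), of c i] by (auto simp: row_def)
    then have "A = B" by auto
    then show ?thesis using ne by simp
  qed
qed

section \<open>Trading a rook of the restriction\<close>

lemma exchange:
  assumes B: "face B" "card B = n * \<nu> + s" and m: "n * (\<nu> + 1) + s \<le> Suc m"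
    and v: "v \<in> restriction B"
  shows "\<exists>B'. face B' \<and> card B' = n * \<nu> + s \<and> B' \<noteq> B \<and> B - {v} \<subseteq> B' \<and> restriction B' \<subseteq> B"
proof -
  obtain c i where vci: "v = (c, i)" by fastforce
  have ci: "(c, i) \<in> B" using v restriction_subset vci by blast
  have cm: "c \<in> {1..m}" and i: "i \<in> {1..n}" using face_bounds[OF B(1) ci] by auto
  \<comment> \<open>The rook moves to the least row with \<open>\<nu>\<close> rooks if \<open>late\<close> holds, and stays in its row
    otherwise; its new column is the \<open>j\<close>-th free one after its removal.\<close>
  define late where "late \<longleftrightarrow> i \<in> big B \<and> (\<exists>j\<in>{1..<i}. j \<notin> big B)"
  define j where "j = (if late then LEAST j. 1 \<le> j \<and> j \<notin> big B else i)"
  have late_j: "1 \<le> j \<and> j \<notin> big B \<and> j < i \<and> (\<forall>l\<in>{1..<j}. l \<in> big B)" if l: late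
  proof -
    obtain j0 where j0: "1 \<le> j0 \<and> j0 \<notin> big B" "j0 < i"
      using l unfolding late_def by (meson atLeastLessThan_iff)
    have jL: "j = (LEAST j. 1 \<le> j \<and> j \<notin> big B)" using l by (simp add: j_def)
    have "1 \<le> j \<and> j \<notin> big B"
      unfolding jL by (rule LeastI[of "\<lambda>j. 1 \<le> j \<and> j \<notin> big B", OF j0(1)])
    moreover have "j \<le> j0"
      unfolding jL by (rule Least_le[of "\<lambda>j. 1 \<le> j \<and> j \<notin> big B", OF j0(1)])
    moreover have "x \<in> big B" if "x \<in> {1..<j}" for x
      using not_less_Least[of x "\<lambda>j. 1 \<le> j \<and> j \<notin> big B"] that unfolding jL[symmetric]
      by simp
    ultimately show ?thesis using j0(2) by simp
  qed
  have late_i: "i \<in> big B" if late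
    using that unfolding late_def by blast
  have j: "j \<in> {1..n}"
  proof (cases late)
    case True then show ?thesis using late_j i by auto
  next
    case False then show ?thesis using i by (simp add: j_def)
  qed
  define X where "X = insert c (free B)"
  have cfree: "c \<notin> free B" using ci by (auto simp: free_def)
  \<comment> \<open>\<open>X\<close> has \<open>m - (n * \<nu> + s) + 1\<close> elements, and the
    bound on \<open>m\<close> says exactly that this is at least \<open>n\<close>, so every row has
    its free column.\<close>
  have "n * \<nu> + n + s \<le> Suc m" using m by (simp add: algebra_simps)
  then have "n \<le> card X" using card_free[OF B(1)] B(2) cfree by (simp add: X_def)
  with j have "j - 1 < card X" by auto
  then obtain f where f: "f \<in> X" "card {x \<in> X. x < f} = j - 1"
    using ex_rank[of X "j - 1"] unfolding X_def by (metis finite_free finite_insert)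
  have fm: "f \<in> {1..m}" using f(1) cm by (auto simp: X_def free_def)
  define B0 where "B0 = B - {(c, i)}"
  define B' where "B' = insert (f, j) B0"
  have fB0: "(f, r) \<notin> B0" for r
    using f(1) face_colD[OF B(1) ci] by (auto simp: B0_def X_def free_def)
  \<comment> \<open>Before \<open>f\<close>, the free columns of \<open>B'\<close> are the elements
    of \<open>X\<close>; so the new rook lies in the gap of its row.\<close>
  have gapf: "gap B' f = j - 1"
  proof -
    have "x \<in> free B0 \<longleftrightarrow> x \<in> X" for x
      using face_colD[OF B(1) ci] cm by (cases "x = c") (auto simp: B0_def X_def free_def)
    moreover have "x \<in> free B' \<longleftrightarrow> x \<in> free B0" if "x < f" for x
      using that by (simp add: B'_def free_def)
    ultimately have "{x \<in> free B'. x < f} = {x \<in> X. x < f}" by blast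
    then show ?thesis using f(2) by (simp add: gap_def)
  qed
  \<comment> \<open>If the rook did not move, \<open>late\<close> would fail and it would be in the
    restriction only for being outside its gap, but rank \<open>i - 1\<close> in \<open>X\<close>
    puts it inside.\<close>
  have ne: "(f, j) \<notin> B"
  proof
    assume "(f, j) \<in> B"
    then have "f = c" "j = i" using fB0[of j] by (auto simp: B0_def)
    then have "\<not> late" using late_j by auto
    then have "Suc (gap B c) \<noteq> i" using v vci by (auto simp: restriction_def late_def)
    moreover have "{x \<in> X. x < c} = {x \<in> free B. x < c}" by (auto simp: X_def)
    then have "gap B c = i - 1" using f(2) \<open>f = c\<close> \<open>j = i\<close> by (simp add: gap_def)
    ultimately show False using i by auto
  qed
  have finB: "finite B" using face_finite[OF B(1)] .
  have crow: "c \<in> row B i" using ci by (simp add: row_def)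
  \<comment> \<open>The formula also covers \<open>i = j\<close>. Truncated subtraction is harmless,
    as row \<open>i\<close> of \<open>B\<close> contains \<open>c\<close>.\<close>
  have cr: "card (row B' l) = (if l = j then 1 else 0) + (card (row B l) - (if l = i then 1 else 0))" for l
  proof -
    have "card (row B' l) = card (row B0 l) + (if l = j then 1 else 0)"
    proof -
      have "f \<notin> row B0 j" using fB0 by (simp add: row_def)
      moreover have "finite (row B0 j)" using finB by (simp add: B0_def finite_row)
      ultimately show ?thesis by (simp add: B'_def row_insert)
    qed
    moreover have "card (row B0 l) = card (row B l) - (if l = i then 1 else 0)"
      using crow by (simp add: B0_def row_remove)
    ultimately show ?thesis by simp
  qed
  have posi: "card (row B i) > 0"
    using crow finite_row[OF finB, of i] unfolding card_gt_0_iff by blast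
  have rows: "card (row B l) = \<nu> + (if l \<in> big B then 1 else 0)" if "l \<in> {1..n}" for l
    using full_row[OF B that] .
  have bigB': "big B' = (if late then insert j (big B - {i}) else big B)"
  proof (cases late)
    case True
    then have "l \<in> big B' \<longleftrightarrow> l \<in> insert j (big B - {i})" for l
    proof (cases "l \<in> {1..n}")
      case l: True
      have ij: "i \<in> big B" "j \<notin> big B" "j \<noteq> i"
        using True late_i late_j by blast+
      have "card (row B' l) = Suc \<nu> \<longleftrightarrow> l \<in> insert j (big B - {i})"
        unfolding cr[of l] rows[OF l] using ij by (cases "l = i"; cases "l = j"; simp)
      then show ?thesis using l by (simp add: big_def[of B'])
    next
      case False
      then show ?thesis using j unfolding big_def by blast
    qed
    then show ?thesis using True by (simp add: set_eq_iff)
  next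
    case False
    then have "j = i" by (simp add: j_def)
    then have "card (row B' l) = card (row B l)" for l
      unfolding cr[of l] using posi by (cases "l = i"; simp)
    then show ?thesis using False by (simp add: big_def)
  qed
  have big_card: "card (big B') = s"
  proof (cases late)
    case True
    then have "i \<in> big B" "j \<notin> big B" using late_i late_j by blast+
    then have "card (big B') = card (big B)" using True bigB'
      using card.remove[OF finite_big, of i B] by simp
    then show ?thesis using full_big[OF B] by simp
  next
    case False
    then show ?thesis using full_big[OF B] bigB' by simp
  qed
  have row_le: "card (row B' l) \<le> Suc \<nu>" if "l \<in> {1..n}" for l
  proof (cases late)
    case True
    then have "j \<notin> big B" using late_j by blast
    then show ?thesis unfolding cr[of l] rows[OF that] using late_i True by simp
  next
    case False
    then have "j = i" by (simp add: j_def)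
    then show ?thesis using face_row_le[OF B(1) that] posi
      unfolding cr[of l] by (cases "l = i"; simp)
  qed
  have "face B'"
    unfolding face_def
  proof (intro conjI allI impI ballI)
    show "B' \<subseteq> {1..m} \<times> {1..n}"
      using B(1) fm j unfolding face_def B'_def B0_def by blast
    show "r = r'" if "(x, r) \<in> B'" "(x, r') \<in> B'" for x r r'
      using that fB0 face_colD[OF B(1), of x r r'] by (auto simp: B'_def B0_def)
  qed (use row_le big_card in auto)
  moreover have "card B' = n * \<nu> + s"
  proof -
    have "card B' = Suc (card B0)"
      unfolding B'_def using fB0 finB by (intro card_insert_disjoint) (simp_all add: B0_def)
    also have "\<dots> = card B" unfolding B0_def using finB ci by (rule card_Suc_Diff1)
    finally show ?thesis using B(2) by simp
  qed
  moreover have "B' \<noteq> B" using ne unfolding B'_def by blast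
  moreover have "B - {v} \<subseteq> B'" unfolding B'_def B0_def vci by blast
  \<comment> \<open>Being in its gap, the new rook could enter the restriction only through a
    smaller row that is not big. If \<open>late\<close> holds, minimality of \<open>j\<close>
    excludes this; otherwise the big rows are unchanged and such a row would make
    \<open>late\<close> true.\<close>
  moreover have "(f, j) \<notin> restriction B'"
  proof
    assume "(f, j) \<in> restriction B'"
    then have *: "j \<in> big B'" "\<exists>l\<in>{1..<j}. l \<notin> big B'"
      using gapf j unfolding restriction_def by auto
    show False
    proof (cases late)
      case True
      then have "l \<in> big B'" if "l \<in> {1..<j}" for l
        using late_j that bigB' by simp
      then show ?thesis using *(2) by blast
    next
      case False
      then have "j = i" "big B' = big B" using bigB' by (simp_all add: j_def)
      then show ?thesis using * False unfolding late_def by blast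
    qed
  qed
  then have "restriction B' \<subseteq> B" using restriction_subset[of B'] unfolding B'_def B0_def by blast
  ultimately show ?thesis by blast
qed

end

section \<open>Assembling the shelling\<close>

theorem theorem4p2:
  fixes m n \<nu> s :: nat and k :: "nat \<Rightarrow> nat"
  assumes "m \<ge> 1" and "n \<ge> 1" and "s \<le> n"
    and "\<And>i. i \<in> {1..s} \<Longrightarrow> k i = \<nu> + 1"
    and "\<And>i. i \<in> {s + 1..n} \<Longrightarrow> k i = \<nu>"
    and "m \<ge> n * (\<nu> + 1) + s - 1"
  shows "shellable (symmetric_multiple_chessboard_complex m n k)"
proof -
  interpret board m n \<nu> s .
  have eq: "symmetric_multiple_chessboard_complex m n k = {A. face A}"
    using assms by (intro symmetric_multiple_chessboard_complex_eq) auto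
  have m: "n * (\<nu> + 1) + s \<le> Suc m" using assms(6) by linarith
  \<comment> \<open>Here \<open>n \<ge> 1\<close> absorbs the successor.\<close>
  then have "n * \<nu> + s \<le> m" using assms(2) by (simp add: algebra_simps)
  then have facets: "facets {A. face A} = {A. face A \<and> card A = n * \<nu> + s}"
    using assms(3) by (rule facets_face[rotated])
  have "{A. face A} \<subseteq> Pow ({1..m} \<times> {1..n})" by (auto simp: face_def)
  then have "finite {A. face A}" by (rule finite_subset) simp
  moreover have "face {}" by (simp add: face_def row_def big_def)
  ultimately have "finite_simplicial_complex {A. face A}"
    using face_finite face_subset unfolding finite_simplicial_complex_def by blast
  then have "shellable {A. face A}"
  proof (rule shellable_if_restriction[where R = restriction and key = key])
    show "\<And>F. F \<in> facets {A. face A} \<Longrightarrow> card F = n * \<nu> + s" unfolding facets by simp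
    show "\<And>F. restriction F \<subseteq> F" by (rule restriction_subset)
    show "key F < key G" if "F \<in> facets {A. face A}" "G \<in> facets {A. face A}" "F \<noteq> G"
      "restriction F \<subseteq> G" for F G
      using that key_less[of G F] unfolding facets by blast
    show "\<exists>G\<in>facets {A. face A}. G \<noteq> F \<and> F - {v} \<subseteq> G \<and> restriction G \<subseteq> F"
      if "F \<in> facets {A. face A}" "v \<in> restriction F" for F v
      using that exchange[of F v] m unfolding facets by blast
  qed
  then show ?thesis unfolding eq .
qed

end
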